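(* Let $f,h$ be $n_v\times n_v$ complex matrices satisfying $i(f^\dagger h-h^\dagger f)=\mathbf 1$ and $f^\dagger\bar h-h^\dagger\bar f=0$, with columns labelled by antisymmetric pairs $AB$ and matter indices $I$, and let $\mathcal N=hf^{-1}$. For real vectors $g=(g^\Lambda)$, $e=(e_\Lambda)\in\mathbb R^{n_v}$ put $$Z_{AB}=h_{\Lambda AB}g^\Lambda-f^\Lambda_{AB}e_\Lambda,\qquad Z_I=h_{\Lambda I}g^\Lambda-f^\Lambda_Ie_\Lambda .$$ Then $$\tfrac12 Z_{AB}\bar Z^{AB}+Z_I\bar Z^I=-\tfrac12\,P^t\,\mathcal M(\mathcal N)\,P,\qquad P=\begin{pmatrix}g\\ e\end{pmatrix},$$ where $$\mathcal M(\mathcal N)=\begin{pmatrix}\mathbf 1&-\mathrm{Re}\,\mathcal N\\ 0&\mathbf 1\end{pmatrix}\begin{pmatrix}\mathrm{Im}\,\mathcal N&0\\ 0&(\mathrm{Im}\,\mathcal N)^{-1}\end{pmatrix}\begin{pmatrix}\mathbf 1&0\\ -\mathrm{Re}\,\mathcal N&\mathbf 1\end{pmatrix}.$$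
   Context: The rows of $f=(f^\Lambda_{AB},f^\Lambda_I)$ and $h=(h_{\Lambda AB},h_{\Lambda I})$ are labelled by $\Lambda=1,\dots,n_v$; the columns are labelled by independent antisymmetric pairs $AB$ ($1\le A<B\le N$) and by $I=1,\dots,n$, so $n_v=N(N-1)/2+n$. Quantities with indices $AB$ are extended antisymmetrically, and repeated indices are summed (over all $A,B$, hence the factor $\frac12$). $\bar Z^{AB}=(Z_{AB})^*$ and $\bar Z^I=(Z_I)^*$. The matrix $\mathcal N$ (the vector kinetic matrix) is symmetric as a consequence of the hypotheses; $\mathrm{Re}$ and $\mathrm{Im}$ are taken entrywise. *)

theory Defs
  imports
    "Jordan_Normal_Form.Gauss_Jordan_Elimination"
    "Jordan_Normal_Form.Schur_Decomposition"
begin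

text \<open>
  Row indices \<open>\<Lambda>\<close> are 0-based, \<open>\<Lambda> < n\<^sub>v\<close>, as usual for this matrix type; the indices
  \<open>A, B\<close> and \<open>I\<close> of the column labels are 1-based.
\<close>

datatype label = PairL nat nat | MatterL nat

definition labels :: "nat \<Rightarrow> nat \<Rightarrow> label set" where
  "labels N n = {PairL A B | A B. 1 \<le> A \<and> A < B \<and> B \<le> N} \<union> {MatterL I | I. 1 \<le> I \<and> I \<le> n}"

text \<open>
  In what follows \<open>c\<close> sends a column label to the number of the column that carries it.
\<close>

definition pair_entry :: "(label \<Rightarrow> nat) \<Rightarrow> complex mat \<Rightarrow> nat \<Rightarrow> nat \<Rightarrow> nat \<Rightarrow> complex" where
  "pair_entry c X \<Lambda> A B =
     (if A < B then X $$ (\<Lambda>, c (PairL A B))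
      else if B < A then - X $$ (\<Lambda>, c (PairL B A))
      else 0)"

definition matter_entry :: "(label \<Rightarrow> nat) \<Rightarrow> complex mat \<Rightarrow> nat \<Rightarrow> nat \<Rightarrow> complex" where
  "matter_entry c X \<Lambda> I = X $$ (\<Lambda>, c (MatterL I))"

definition Z_pair :: "(label \<Rightarrow> nat) \<Rightarrow> complex mat \<Rightarrow> complex mat \<Rightarrow> real vec \<Rightarrow> real vec
    \<Rightarrow> nat \<Rightarrow> nat \<Rightarrow> complex" where
  "Z_pair c f h g e A B =
     (\<Sum>\<Lambda><dim_row h. pair_entry c h \<Lambda> A B * of_real (g $ \<Lambda>))
     - (\<Sum>\<Lambda><dim_row f. pair_entry c f \<Lambda> A B * of_real (e $ \<Lambda>))"

definition Z_matter :: "(label \<Rightarrow> nat) \<Rightarrow> complex mat \<Rightarrow> complex mat \<Rightarrow> real vec \<Rightarrow> real vec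
    \<Rightarrow> nat \<Rightarrow> complex" where
  "Z_matter c f h g e I =
     (\<Sum>\<Lambda><dim_row h. matter_entry c h \<Lambda> I * of_real (g $ \<Lambda>))
     - (\<Sum>\<Lambda><dim_row f. matter_entry c f \<Lambda> I * of_real (e $ \<Lambda>))"

text \<open>
  \<open>mat_inverse\<close> is option-valued; \<open>mat_inv A\<close> is unspecified when \<open>A\<close> is not invertible.
\<close>

definition mat_inv :: "'a::field mat \<Rightarrow> 'a mat" where
  "mat_inv A = the (mat_inverse A)"

definition kinetic_mat :: "complex mat \<Rightarrow> complex mat \<Rightarrow> complex mat" where
  "kinetic_mat f h = h * mat_inv f"

definition M_mat :: "complex mat \<Rightarrow> real mat" where
  "M_mat X =
     (let k = dim_row X; R = map_mat Re X; J = map_mat Im X in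
        four_block_mat (1\<^sub>m k) (- R) (0\<^sub>m k k) (1\<^sub>m k)
        * four_block_mat J (0\<^sub>m k k) (0\<^sub>m k k) (mat_inv J)
        * four_block_mat (1\<^sub>m k) (0\<^sub>m k k) (- R) (1\<^sub>m k))"

end

theory Submission
  imports Defs
begin

text \<open>
  Write \<open>h = K f\<close>; here \<open>f\<close> is invertible because \<open>f v = 0\<close> and the first hypothesis give
  \<open>v\<^sup>\<dagger> v = 0\<close>. The second hypothesis says that \<open>K\<close> is symmetric, and the first one then becomes
  \<open>-2 (Im K) (f f\<^sup>\<dagger>) = 1\<close>; in particular \<open>f f\<^sup>\<dagger>\<close> is a real matrix. The charges are
  \<open>Z = f\<^sup>t (K g - e)\<close>, so the sum of their squared moduli is the quadratic form of \<open>f f\<^sup>\<dagger>\<close>, evaluated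
  on the real part \<open>(Re K) g - e\<close> and on the imaginary part \<open>(Im K) g\<close> of \<open>K g - e\<close>.
\<close>

section \<open>Adjoints, entrywise maps and inverses of matrices\<close>

lemma mat_adjoint_eq: "mat_adjoint A = (map_mat cnj A)\<^sup>T" for A :: "complex mat"
  by (rule eq_matI) (auto simp: mat_adjoint_def mat_of_rows_def)

lemma map_mat_cnj_mult:
  "A \<in> carrier_mat m k \<Longrightarrow> B \<in> carrier_mat k n \<Longrightarrow>
    map_mat cnj (A * B) = map_mat cnj A * map_mat cnj B"
  by (rule eq_matI) (auto simp: scalar_prod_def)

lemma map_mat_Re_of_real_mult:
  "A \<in> carrier_mat m k \<Longrightarrow> B \<in> carrier_mat k n \<Longrightarrow>
    map_mat Re (map_mat of_real A * B) = A * map_mat Re B"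
  by (rule eq_matI) (auto simp: scalar_prod_def)

lemma mat_adjoint_carrier [simp]:
  "A \<in> carrier_mat m n \<Longrightarrow> mat_adjoint A \<in> carrier_mat n m" for A :: "complex mat"
  by (auto simp: mat_adjoint_eq)

lemma mat_adjoint_dim [simp]:
  "dim_row (mat_adjoint A) = dim_col A" "dim_col (mat_adjoint A) = dim_row A" for A :: "complex mat"
  by (simp_all add: mat_adjoint_eq)

lemma mat_adjoint_mult:
  "A \<in> carrier_mat m k \<Longrightarrow> B \<in> carrier_mat k n \<Longrightarrow>
    mat_adjoint (A * B) = mat_adjoint B * mat_adjoint A" for A B :: "complex mat"
  by (simp add: mat_adjoint_eq map_mat_cnj_mult[of A m k B n] transpose_mult[of _ m k _ n])

lemma smult_mat_mult_vec:
  "A \<in> carrier_mat m n \<Longrightarrow> v \<in> carrier_vec n \<Longrightarrow>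
    (k \<cdot>\<^sub>m A) *\<^sub>v v = k \<cdot>\<^sub>v (A *\<^sub>v v)" for k :: "'a::comm_semiring_0"
  by (rule eq_vecI) (auto simp: scalar_prod_def sum_distrib_left mult.assoc)

lemma zero_mat_mult_vec: "v \<in> carrier_vec n \<Longrightarrow> 0\<^sub>m m n *\<^sub>v v = 0\<^sub>v m"
  by (rule eq_vecI) auto

lemma invertible_matI:
  assumes "(A :: 'a::field mat) \<in> carrier_mat n n" "B \<in> carrier_mat n n" "A * B = 1\<^sub>m n"
  shows "invertible_mat A"
  using assms mat_mult_left_right_inverse[OF assms]
  by (auto simp: invertible_mat_def inverts_mat_def)

text \<open>Over a field, a right inverse of a square matrix is also a left inverse. Hence
  \<open>A\<close> is a unit, \<open>mat_inverse\<close> returns a value, and uniqueness of inverses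
  identifies that value with \<open>B\<close>.\<close>

lemma mat_inv_eqI:
  assumes A: "A \<in> carrier_mat n n" and B: "B \<in> carrier_mat n n" and AB: "A * B = 1\<^sub>m n"
  shows "mat_inv A = B"
proof -
  have BA: "B * A = 1\<^sub>m n" by (rule mat_mult_left_right_inverse[OF A B AB])
  have "A \<in> Units (ring_mat TYPE('a) n ())"
    using A B AB BA unfolding Units_def by (auto simp: ring_mat_def)
  then obtain C where C: "mat_inverse A = Some C"
    using mat_inverse(1)[OF A, where b = "()"] by fastforce
  then have AC: "A * C = 1\<^sub>m n" and C': "C \<in> carrier_mat n n"
    using mat_inverse(2)[OF A] by auto
  have "C = B * A * C" using BA C' by simp
  also have "\<dots> = B" using A B C' AC by (simp add: assoc_mult_mat[of _ n n _ n _ n])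
  finally show ?thesis using C by (simp add: mat_inv_def)
qed

section \<open>Hermitian forms\<close>

text \<open>The transpose moves across the bilinear product as \<open>A\<close>, and conjugating the
  second factor produces the adjoint. With \<open>A = f\<close> this expresses the sum of the
  squared moduli of the charges through \<open>f * mat_adjoint f\<close>.\<close>

lemma cnj_transpose_mult_vec_scalar_prod:
  fixes A :: "complex mat"
  assumes A: "A \<in> carrier_mat m n" and v: "v \<in> carrier_vec m"
  shows "(A\<^sup>T *\<^sub>v v) \<bullet>c (A\<^sup>T *\<^sub>v v) = v \<bullet> ((A * mat_adjoint A) *\<^sub>v conjugate v)"
proof -
  have "conjugate (A\<^sup>T *\<^sub>v v) = mat_adjoint A *\<^sub>v conjugate v"
    using A v by (intro eq_vecI) (auto simp: mat_adjoint_eq scalar_prod_def)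
  moreover have "mat_adjoint A *\<^sub>v conjugate v \<in> carrier_vec n"
    using A v by (simp add: mult_mat_vec_carrier[of _ n m])
  ultimately show ?thesis
    using A v by (simp add: transpose_vec_mult_scalar[of A m n] assoc_mult_mat_vec[of _ m n _ m])
qed

text \<open>For real coefficients, the products mixing entries of \<open>x\<close> with entries of
  \<open>y\<close> are purely imaginary, so taking the real part removes them term by term.\<close>

lemma real_matrix_hermitian_form:
  fixes x y :: "real vec"
  assumes "G \<in> carrier_mat n n" "x \<in> carrier_vec n" "y \<in> carrier_vec n" "v \<in> carrier_vec n"
    and "\<And>i. i < n \<Longrightarrow> v $ i = Complex (x $ i) (y $ i)"
  shows "Re (v \<bullet> (map_mat of_real G *\<^sub>v conjugate v)) = x \<bullet> (G *\<^sub>v x) + y \<bullet> (G *\<^sub>v y)"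
proof -
  have "Re (v \<bullet> (map_mat of_real G *\<^sub>v conjugate v))
      = (\<Sum>i<n. \<Sum>j<n. Re (v $ i * (of_real (G $$ (i, j)) * cnj (v $ j))))"
    using assms(1-4) by (simp add: scalar_prod_def sum_distrib_left lessThan_atLeast0)
  also have "\<dots> = (\<Sum>i<n. \<Sum>j<n. x $ i * (G $$ (i, j) * x $ j) + y $ i * (G $$ (i, j) * y $ j))"
    by (intro sum.cong refl) (simp add: assms(5))
  also have "\<dots> = x \<bullet> (G *\<^sub>v x) + y \<bullet> (G *\<^sub>v y)"
    using assms(1-4) by (simp add: scalar_prod_def sum_distrib_left lessThan_atLeast0 sum.distrib)
  finally show ?thesis .
qed

section \<open>Consequences of the two hypotheses on \<open>f\<close> and \<open>h\<close>\<close>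

text \<open>Evaluate the hypothesis as a Hermitian form at a vector \<open>v\<close> of the kernel
  of \<open>f\<close>. Both terms then contain the factor \<open>f *\<^sub>v v\<close>, one directly
  and one after the adjoint of \<open>f\<close> has been moved to the other side. So
  \<open>v\<close> has norm zero, and \<open>det f\<close> is nonzero.\<close>

lemma fh_invertible:
  assumes f: "f \<in> carrier_mat n n" and h: "h \<in> carrier_mat n n"
    and fh: "\<i> \<cdot>\<^sub>m (mat_adjoint f * h - mat_adjoint h * f) = 1\<^sub>m n"
  obtains F where "F \<in> carrier_mat n n" "f * F = 1\<^sub>m n" "F * f = 1\<^sub>m n"
proof -
  have "v = 0\<^sub>v n" if v: "v \<in> carrier_vec n" and fv: "f *\<^sub>v v = 0\<^sub>v n" for v
  proof -
    have "v = (\<i> \<cdot>\<^sub>m (mat_adjoint f * h - mat_adjoint h * f)) *\<^sub>v v"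
      using v fh by simp
    also have "\<dots> = \<i> \<cdot>\<^sub>v ((mat_adjoint f * h - mat_adjoint h * f) *\<^sub>v v)"
      using f h v by (intro smult_mat_mult_vec[of _ n n] minus_carrier_mat mult_carrier_mat[of _ n n]) auto
    also have "(mat_adjoint f * h - mat_adjoint h * f) *\<^sub>v v
        = mat_adjoint f *\<^sub>v (h *\<^sub>v v) - mat_adjoint h *\<^sub>v (f *\<^sub>v v)"
      using f h v by (simp add: minus_mult_distrib_mat_vec[of _ n n] assoc_mult_mat_vec[of _ n n _ n]
          mult_carrier_mat[of _ n n])
    also have "\<dots> = mat_adjoint f *\<^sub>v (h *\<^sub>v v)"
      using f h v fv by (intro eq_vecI) auto
    finally have "v \<bullet>c v = (\<i> \<cdot>\<^sub>v (mat_adjoint f *\<^sub>v (h *\<^sub>v v))) \<bullet>c v"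
      by simp
    also have "\<dots> = \<i> * ((h *\<^sub>v v) \<bullet> (map_mat cnj f *\<^sub>v conjugate v))"
      using f h v by (simp add: mat_adjoint_eq transpose_vec_mult_scalar[of _ n n])
    also have "map_mat cnj f *\<^sub>v conjugate v = conjugate (f *\<^sub>v v)"
      using f v by (intro eq_vecI) (auto simp: scalar_prod_def)
    also have "(h *\<^sub>v v) \<bullet> conjugate (f *\<^sub>v v) = 0"
      using f h v fv by simp
    finally show ?thesis using conjugate_square_eq_0_vec[OF v] by simp
  qed
  then have "det f \<noteq> 0" using det_0_iff_vec_prod_zero[OF f] by blast
  from det_non_zero_imp_unit[OF f this, of "()"] show ?thesis
    using that by (auto simp: Units_def ring_mat_def)
qed

text \<open>Inserting \<open>h = K * f\<close> turns each hypothesis into a matrix built from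
  \<open>K\<close> between two invertible factors, which can then be cancelled or moved. Reality of
  \<open>f * mat_adjoint f\<close> follows because it is the inverse of a real matrix.\<close>

lemma kinetic_mat_identities:
  assumes f: "f \<in> carrier_mat n n" and h: "h \<in> carrier_mat n n" and K: "K \<in> carrier_mat n n"
    and F: "F \<in> carrier_mat n n" and fF: "f * F = 1\<^sub>m n"
    and hK: "h = K * f"
    and fh1: "\<i> \<cdot>\<^sub>m (mat_adjoint f * h - mat_adjoint h * f) = 1\<^sub>m n"
    and fh2: "mat_adjoint f * map_mat cnj h - mat_adjoint h * map_mat cnj f = 0\<^sub>m n n"
  shows kinetic_mat_sym: "K\<^sup>T = K"
    and kinetic_mat_Im: "map_mat Im K * (- 2 \<cdot>\<^sub>m map_mat Re (f * mat_adjoint f)) = 1\<^sub>m n"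
    and ff_adjoint_real: "f * mat_adjoint f = map_mat of_real (map_mat Re (f * mat_adjoint f))"
proof -
  let ?a = "mat_adjoint :: complex mat \<Rightarrow> complex mat" and ?c = "map_mat cnj"
  have c: "?c f \<in> carrier_mat n n" "?c F \<in> carrier_mat n n" "?c K \<in> carrier_mat n n"
    "?a f \<in> carrier_mat n n" "?a F \<in> carrier_mat n n" "?a K \<in> carrier_mat n n"
    using f F K by auto
  note assoc = assoc_mult_mat[of _ n n _ n _ n]
  note distr = mult_minus_distrib_mat[of _ n n _ n] minus_mult_distrib_mat[of _ n n _ _ n]
  note carrier = mult_carrier_mat[of _ n n _ n]
  have one: "?c (1\<^sub>m n) = 1\<^sub>m n" "?a (1\<^sub>m n) = 1\<^sub>m n"
    by (auto simp: mat_adjoint_eq intro!: eq_matI)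
  have cfF: "?c f * ?c F = 1\<^sub>m n" using map_mat_cnj_mult[OF f F] fF one by simp
  have aFf: "?a F * ?a f = 1\<^sub>m n" using mat_adjoint_mult[OF f F] fF one by simp
  have ch: "?c h = ?c K * ?c f" and ah: "?a h = ?a f * ?a K"
    using map_mat_cnj_mult[OF K f] mat_adjoint_mult[OF K f] hK by auto
  \<comment> \<open>\<open>D\<close> measures the failure of \<open>K\<close> to be symmetric: it is
    the conjugate of \<open>K\<close> minus its transpose. The second hypothesis is the vanishing of
    \<open>?a f * D * ?c f\<close>.\<close>
  define D where "D = ?c K - ?a K"
  have D: "D \<in> carrier_mat n n" unfolding D_def by (rule minus_carrier_mat) (rule c(6))
  have "?a f * D * ?c f = ?a f * ?c h - ?a h * ?c f"
    using c unfolding ch ah D_def by (simp add: assoc distr carrier)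
  then have zero: "?a f * D * ?c f = 0\<^sub>m n n" using fh2 by simp
  have "D = (?a F * ?a f) * D * (?c f * ?c F)"
    unfolding aFf cfF using D by simp
  also have "\<dots> = ?a F * (?a f * D * ?c f) * ?c F"
    using c D by (simp add: assoc carrier del: map_carrier_mat)
  also have "\<dots> = 0\<^sub>m n n" unfolding zero using c by simp
  finally have D0: "D = 0\<^sub>m n n" .
  have aK: "?a K $$ (i,j) = ?c K $$ (i,j)" if "i < n" "j < n" for i j
  proof -
    have "D $$ (i,j) = ?c K $$ (i,j) - ?a K $$ (i,j)"
      unfolding D_def using that K by (intro index_minus_mat) auto
    then show ?thesis using D0 that by simp
  qed
  then have aK': "?a K = ?c K" using c by (intro eq_matI) auto
  show sym: "K\<^sup>T = K"
    using aK K by (intro eq_matI) (auto simp: mat_adjoint_eq)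
  define X where "X = K - ?c K"
  have X: "X \<in> carrier_mat n n" unfolding X_def by (rule minus_carrier_mat) (rule c(3))
  have "?a f * h - ?a h * f = ?a f * (X * f)"
    unfolding ah aK' unfolding hK X_def using c f K by (simp add: assoc distr carrier)
  then have "?a f * (\<i> \<cdot>\<^sub>m (X * f)) = 1\<^sub>m n"
    using fh1 c X f by (simp add: mult_smult_distrib[of _ n n _ n] carrier)
  \<comment> \<open>One-sided inverses of square matrices are two-sided. Exchanging the factors
    brings \<open>f\<close> next to its adjoint, in the order needed for
    \<open>f * ?a f\<close>.\<close>
  then have "(\<i> \<cdot>\<^sub>m (X * f)) * ?a f = 1\<^sub>m n"
    using mat_mult_left_right_inverse[of "?a f" n] c X f by simp
  then have XS: "\<i> \<cdot>\<^sub>m X * (f * ?a f) = 1\<^sub>m n"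
    using c X f by (simp add: assoc mult_smult_assoc_mat[of _ n n _ n] carrier)
  define S where "S = f * ?a f"
  let ?J = "map_mat Im K" and ?G = "map_mat Re S"
  have S: "S \<in> carrier_mat n n" using f c by (simp add: S_def carrier)
  note XS = XS[folded S_def]
  \<comment> \<open>\<open>X\<close> is \<open>2 * \<i>\<close> times the imaginary part of
    \<open>K\<close>, so the extra factor \<open>\<i>\<close> makes it real.\<close>
  have iX: "\<i> \<cdot>\<^sub>m X = map_mat of_real (- 2 \<cdot>\<^sub>m ?J)"
    using K by (intro eq_matI) (auto simp: X_def complex_eq_iff)
  \<comment> \<open>This is the real part of \<open>XS\<close>: the left factor there is real, so
    \<open>Re\<close> acts on \<open>S\<close> alone.\<close>
  have JG: "?J * (- 2 \<cdot>\<^sub>m ?G) = 1\<^sub>m n"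
  proof -
    have "?J * (- 2 \<cdot>\<^sub>m ?G) = (- 2 \<cdot>\<^sub>m ?J) * ?G"
      using K S by (simp add: mult_smult_distrib[of _ n n _ n] mult_smult_assoc_mat[of _ n n _ n])
    also have "\<dots> = map_mat Re (map_mat of_real (- 2 \<cdot>\<^sub>m ?J) * S)"
      using K S by (intro map_mat_Re_of_real_mult[symmetric]) auto
    also have "\<dots> = 1\<^sub>m n"
      using XS unfolding iX by (auto intro!: eq_matI)
    finally show ?thesis .
  qed
  have "map_mat of_real (- 2 \<cdot>\<^sub>m ?J) * map_mat of_real ?G
      = map_mat complex_of_real ((- 2 \<cdot>\<^sub>m ?J) * ?G)"
    using K S by (intro of_real_hom.mat_hom_mult[symmetric]) auto
  also have "(- 2 \<cdot>\<^sub>m ?J) * ?G = 1\<^sub>m n"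
    using JG K S by (simp add: mult_smult_distrib[of _ n n _ n] mult_smult_assoc_mat[of _ n n _ n])
  also have "map_mat complex_of_real (1\<^sub>m n) = 1\<^sub>m n"
    by (rule of_real_hom.mat_hom_one)
  finally have "map_mat of_real (- 2 \<cdot>\<^sub>m ?J) * map_mat of_real ?G = (1\<^sub>m n :: complex mat)" .
  \<comment> \<open>Both \<open>S\<close> and its real part are right inverses of the same matrix,
    so they coincide.\<close>
  then have "mat_inv (\<i> \<cdot>\<^sub>m X) = map_mat of_real ?G"
    unfolding iX using K S by (intro mat_inv_eqI[of _ n]) auto
  then have "S = map_mat of_real ?G"
    using mat_inv_eqI[OF _ S XS] X by simp
  with JG show "?J * (- 2 \<cdot>\<^sub>m map_mat Re (f * ?a f)) = 1\<^sub>m n"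
    and "f * ?a f = map_mat of_real (map_mat Re (f * ?a f))"
    unfolding S_def .
qed

section \<open>The quadratic form of \<open>M_mat\<close>\<close>

text \<open>Since \<open>Re K\<close> is symmetric, the outer block factors of
  \<open>M_mat K\<close> are transposes of each other. The form is therefore that of the block
  diagonal factor at the vector \<open>g @\<^sub>v (- x)\<close>, and the sign of \<open>x\<close>
  drops out.\<close>

lemma M_mat_quadratic_form:
  fixes g e :: "real vec"
  assumes K: "K \<in> carrier_mat n n" and sym: "K\<^sup>T = K"
    and Ji: "mat_inv (map_mat Im K) \<in> carrier_mat n n"
    and g: "g \<in> carrier_vec n" and e: "e \<in> carrier_vec n"
  defines "x \<equiv> map_mat Re K *\<^sub>v g - e"
  shows "(g @\<^sub>v e) \<bullet> (M_mat K *\<^sub>v (g @\<^sub>v e))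
    = g \<bullet> (map_mat Im K *\<^sub>v g) + x \<bullet> (mat_inv (map_mat Im K) *\<^sub>v x)"
proof -
  let ?R = "map_mat Re K" and ?J = "map_mat Im K"
  let ?Ji = "mat_inv ?J"
  have R: "?R \<in> carrier_mat n n" and J: "?J \<in> carrier_mat n n" using K by auto
  have R': "- ?R \<in> carrier_mat n n" using R by simp
  have Rsym: "?R\<^sup>T = ?R" using arg_cong[OF sym, of "map_mat Re"] K
    by (metis map_mat_transpose)
  have x: "x \<in> carrier_vec n" using R g e by (simp add: x_def)
  have negx: "- ?R *\<^sub>v g + 1\<^sub>m n *\<^sub>v e = - x"
    using K g e by (intro eq_vecI) (auto simp: x_def)
  let ?q = "?Ji *\<^sub>v (- x)"
  have q: "?q \<in> carrier_vec n" using Ji x by simp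
  let ?A = "four_block_mat (1\<^sub>m n) (- ?R) (0\<^sub>m n n) (1\<^sub>m n)"
    and ?D = "four_block_mat ?J (0\<^sub>m n n) (0\<^sub>m n n) ?Ji"
    and ?B = "four_block_mat (1\<^sub>m n) (0\<^sub>m n n) (- ?R) (1\<^sub>m n)"
  have ABD: "?A \<in> carrier_mat (n+n) (n+n)" "?D \<in> carrier_mat (n+n) (n+n)"
    "?B \<in> carrier_mat (n+n) (n+n)" using J Ji by auto
  have P: "g @\<^sub>v e \<in> carrier_vec (n+n)" using g e by auto
  have "M_mat K *\<^sub>v (g @\<^sub>v e) = ?A *\<^sub>v (?D *\<^sub>v (?B *\<^sub>v (g @\<^sub>v e)))"
    using K ABD P by (simp add: M_mat_def Let_def assoc_mult_mat_vec[of _ "n+n" "n+n" _ "n+n"]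
        del: four_block_carrier_mat)
  also have "?B *\<^sub>v (g @\<^sub>v e) = g @\<^sub>v (- x)"
    using four_block_mat_mult_vec[OF one_carrier_mat zero_carrier_mat R' one_carrier_mat g e]
      g e negx by (simp add: zero_mat_mult_vec)
  also have "?D *\<^sub>v \<dots> = (?J *\<^sub>v g) @\<^sub>v ?q"
    by (rule mult_mat_vec_split) (use J Ji g x in auto)
  also have "?A *\<^sub>v \<dots> = (?J *\<^sub>v g - ?R *\<^sub>v ?q) @\<^sub>v ?q"
  proof -
    have Jg: "?J *\<^sub>v g \<in> carrier_vec n" using J g by simp
    have "?J *\<^sub>v g + (- ?R) *\<^sub>v ?q = ?J *\<^sub>v g - ?R *\<^sub>v ?q"
      using K Jg Ji q by (intro eq_vecI) auto
    then show ?thesis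
      using four_block_mat_mult_vec[OF one_carrier_mat R' zero_carrier_mat one_carrier_mat Jg q]
        Jg q by (simp add: zero_mat_mult_vec)
  qed
  finally have "(g @\<^sub>v e) \<bullet> (M_mat K *\<^sub>v (g @\<^sub>v e))
      = g \<bullet> (?J *\<^sub>v g - ?R *\<^sub>v ?q) + e \<bullet> ?q"
    using scalar_prod_append[OF g e, of "?J *\<^sub>v g - ?R *\<^sub>v ?q" ?q] J R g q by simp
  also have "\<dots> = g \<bullet> (?J *\<^sub>v g) - (g \<bullet> (?R *\<^sub>v ?q) - e \<bullet> ?q)"
    using J R g q by (simp add: scalar_prod_minus_distrib[of _ n])
  \<comment> \<open>Symmetry of the real part shifts it onto \<open>g\<close>, where it combines
    with \<open>e\<close> to give \<open>x\<close>.\<close>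
  also have "g \<bullet> (?R *\<^sub>v ?q) = (?R *\<^sub>v g) \<bullet> ?q"
    using transpose_vec_mult_scalar[OF R q g] Rsym by simp
  also have "(?R *\<^sub>v g) \<bullet> ?q - e \<bullet> ?q = x \<bullet> ?q"
    using R g e q by (simp add: x_def minus_scalar_prod_distrib[of _ n])
  also have "?q = - (?Ji *\<^sub>v x)"
    using Ji x by (intro eq_vecI) auto
  also have "x \<bullet> (- (?Ji *\<^sub>v x)) = - (x \<bullet> (?Ji *\<^sub>v x))"
    using Ji x by simp
  finally show ?thesis by simp
qed

section \<open>Summation over the column labels\<close>

text \<open>The index square splits into the strict upper triangle, its mirror image and the
  diagonal. The resulting factor 2 cancels the 1/2 of the summation convention for antisymmetric
  pairs.\<close>

lemma sum_symmetric_zero_diagonal: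
  fixes t :: "nat \<Rightarrow> nat \<Rightarrow> 'a::comm_semiring_1"
  assumes "\<And>A B. t A B = t B A" "\<And>A. t A A = 0"
  shows "(\<Sum>A = 1..N. \<Sum>B = 1..N. t A B)
    = 2 * (\<Sum>(A, B)\<in>{(A, B). 1 \<le> A \<and> A < B \<and> B \<le> N}. t A B)"
proof -
  let ?U = "{(A, B). 1 \<le> A \<and> A < B \<and> B \<le> N}" and ?D = "(\<lambda>A. (A, A)) ` {1..N}"
  have fin: "finite ?U" by (rule finite_subset[of _ "{1..N} \<times> {1..N}"]) auto
  have "(\<Sum>A = 1..N. \<Sum>B = 1..N. t A B) = (\<Sum>(A, B)\<in>{1..N} \<times> {1..N}. t A B)"
    by (simp add: sum.cartesian_product)
  also have "{1..N} \<times> {1..N} = (?U \<union> prod.swap ` ?U) \<union> ?D"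
    by (auto simp: image_iff prod.swap_def)
  also have "(\<Sum>(A, B)\<in>\<dots>. t A B)
      = (\<Sum>(A, B)\<in>?U. t A B) + (\<Sum>(A, B)\<in>prod.swap ` ?U. t A B) + (\<Sum>(A, B)\<in>?D. t A B)"
    using fin by (subst sum.union_disjoint, auto)+
  also have "(\<Sum>(A, B)\<in>?D. t A B) = 0"
    by (rule sum.neutral) (auto simp: assms)
  also have "(\<Sum>(A, B)\<in>prod.swap ` ?U. t A B) = (\<Sum>(A, B)\<in>?U. t A B)"
    by (subst sum.reindex) (auto intro!: sum.cong simp: assms(1))
  finally show ?thesis by (simp add: mult_2)
qed

lemma sum_labels:
  "(\<Sum>l\<in>labels N n. t l)
    = (\<Sum>(A, B)\<in>{(A, B). 1 \<le> A \<and> A < B \<and> B \<le> N}. t (PairL A B)) + (\<Sum>I = 1..n. t (MatterL I))"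
proof -
  let ?U = "{(A, B). 1 \<le> A \<and> A < B \<and> B \<le> N}"
  have fin: "finite ?U" by (rule finite_subset[of _ "{1..N} \<times> {1..N}"]) auto
  have "labels N n = (\<lambda>(A, B). PairL A B) ` ?U \<union> MatterL ` {1..n}"
    by (auto simp: labels_def image_iff)
  moreover have "(\<Sum>l\<in>\<dots>. t l)
      = (\<Sum>l\<in>(\<lambda>(A, B). PairL A B) ` ?U. t l) + (\<Sum>l\<in>MatterL ` {1..n}. t l)"
    using fin by (intro sum.union_disjoint) auto
  moreover have "(\<Sum>l\<in>(\<lambda>(A, B). PairL A B) ` ?U. t l) = (\<Sum>(A, B)\<in>?U. t (PairL A B))"
    by (subst sum.reindex) (auto simp: inj_on_def intro!: sum.cong)
  moreover have "(\<Sum>l\<in>MatterL ` {1..n}. t l) = (\<Sum>I = 1..n. t (MatterL I))"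
    by (subst sum.reindex) (auto simp: inj_on_def)
  ultimately show ?thesis by simp
qed

text \<open>Halving the double sum counts each independent pair once. As \<open>c\<close> numbers
  the labels bijectively, the charges are then exactly the components of \<open>z\<close>, each
  occurring once.\<close>

lemma sum_Z_eq_sum_columns:
  fixes g e :: "real vec"
  assumes c: "bij_betw c (labels N n) {..<nv}"
    and f: "f \<in> carrier_mat nv nv" and h: "h \<in> carrier_mat nv nv"
    and g: "g \<in> carrier_vec nv" and e: "e \<in> carrier_vec nv"
  defines "z \<equiv> h\<^sup>T *\<^sub>v map_vec of_real g - f\<^sup>T *\<^sub>v map_vec of_real e"
  shows "1 / 2 * (\<Sum>A = 1..N. \<Sum>B = 1..N. Z_pair c f h g e A B * cnj (Z_pair c f h g e A B))
      + (\<Sum>I = 1..n. Z_matter c f h g e I * cnj (Z_matter c f h g e I)) = z \<bullet>c z"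
proof -
  let ?U = "{(A, B). 1 \<le> A \<and> A < B \<and> B \<le> N}"
  define w where "w = (\<lambda>k. z $ k * cnj (z $ k))"
  have c_lt: "c l < nv" if "l \<in> labels N n" for l
    using c that by (auto simp: bij_betw_def)
  have z_eq: "z $ k = (\<Sum>\<Lambda><nv. h $$ (\<Lambda>, k) * of_real (g $ \<Lambda>))
      - (\<Sum>\<Lambda><nv. f $$ (\<Lambda>, k) * of_real (e $ \<Lambda>))" if "k < nv" for k
    using f h g e that by (simp add: z_def scalar_prod_def lessThan_atLeast0)
  have Zp: "Z_pair c f h g e A B = z $ c (PairL A B)" if "(A, B) \<in> ?U" for A B
    using that f h z_eq[OF c_lt[of "PairL A B"]]
    by (auto simp: Z_pair_def pair_entry_def labels_def)
  have Zm: "Z_matter c f h g e I = z $ c (MatterL I)" if "I \<in> {1..n}" for I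
    using that f h z_eq[OF c_lt[of "MatterL I"]]
    by (auto simp: Z_matter_def matter_entry_def labels_def)
  have anti: "Z_pair c f h g e A B = - Z_pair c f h g e B A" for A B
  proof -
    have "pair_entry c X \<Lambda> A B = - pair_entry c X \<Lambda> B A" for X \<Lambda>
      by (simp add: pair_entry_def)
    then show ?thesis
      by (simp add: Z_pair_def sum_negf)
  qed
  have diag: "Z_pair c f h g e A A = 0" for A
    by (simp add: Z_pair_def pair_entry_def)
  have "(\<Sum>A = 1..N. \<Sum>B = 1..N. Z_pair c f h g e A B * cnj (Z_pair c f h g e A B))
      = 2 * (\<Sum>(A, B)\<in>?U. Z_pair c f h g e A B * cnj (Z_pair c f h g e A B))"
  proof (rule sum_symmetric_zero_diagonal)
    show "Z_pair c f h g e A B * cnj (Z_pair c f h g e A B)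
        = Z_pair c f h g e B A * cnj (Z_pair c f h g e B A)" for A B
      \<comment> \<open>The signs from the charge and from its conjugate cancel.\<close>
      by (subst (1 2) anti) simp
  qed (simp add: diag)
  moreover have "(\<Sum>(A, B)\<in>?U. Z_pair c f h g e A B * cnj (Z_pair c f h g e A B))
      = (\<Sum>(A, B)\<in>?U. w (c (PairL A B)))"
    by (rule sum.cong) (auto simp: Zp w_def)
  moreover have "(\<Sum>I = 1..n. Z_matter c f h g e I * cnj (Z_matter c f h g e I))
      = (\<Sum>I = 1..n. w (c (MatterL I)))"
    by (rule sum.cong) (auto simp: Zm w_def)
  moreover have "(\<Sum>l\<in>labels N n. w (c l)) = (\<Sum>k<nv. w k)"
    by (rule sum.reindex_bij_betw[OF c])
  moreover have "z \<bullet>c z = (\<Sum>k<nv. w k)"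
    using f by (simp add: z_def w_def scalar_prod_def lessThan_atLeast0)
  ultimately show ?thesis
    using sum_labels[of "\<lambda>l. w (c l)" N n] by simp
qed

section \<open>The sum rule for the charges\<close>

text \<open>The two invertibility claims ensure that \<open>mat_inv\<close> inside
  \<open>kinetic_mat\<close> and \<open>M_mat\<close> denotes a genuine inverse. The equation holds
  between complex numbers, so it also asserts that the left-hand side is real.\<close>

theorem mainTheorem2:
  fixes N n nv :: nat
    and c :: "label \<Rightarrow> nat"
    and f h :: "complex mat"
    and g e :: "real vec"
  assumes nv: "nv = N * (N - 1) div 2 + n"
    and c: "bij_betw c (labels N n) {..<nv}"
    and f: "f \<in> carrier_mat nv nv"
    and h: "h \<in> carrier_mat nv nv"
    and fh1: "\<i> \<cdot>\<^sub>m (mat_adjoint f * h - mat_adjoint h * f) = 1\<^sub>m nv"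
    and fh2: "mat_adjoint f * map_mat cnj h - mat_adjoint h * map_mat cnj f = 0\<^sub>m nv nv"
    and g: "g \<in> carrier_vec nv"
    and e: "e \<in> carrier_vec nv"
  shows "invertible_mat f \<and> invertible_mat (map_mat Im (kinetic_mat f h)) \<and>
    1 / 2 * (\<Sum>A = 1..N. \<Sum>B = 1..N. Z_pair c f h g e A B * cnj (Z_pair c f h g e A B))
      + (\<Sum>I = 1..n. Z_matter c f h g e I * cnj (Z_matter c f h g e I))
    = complex_of_real
        (- (1 / 2) * ((g @\<^sub>v e) \<bullet> (M_mat (kinetic_mat f h) *\<^sub>v (g @\<^sub>v e))))"
proof -
  obtain F where F: "F \<in> carrier_mat nv nv" and fF: "f * F = 1\<^sub>m nv" and Ff: "F * f = 1\<^sub>m nv"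
    using fh_invertible[OF f h fh1] .
  define K where "K = kinetic_mat f h"
  have K_eq: "K = h * F"
    by (simp add: K_def kinetic_mat_def mat_inv_eqI[OF f F fF])
  have K: "K \<in> carrier_mat nv nv" using K_eq h F by simp
  have hK: "h = K * f"
    using h F f Ff by (simp add: K_eq assoc_mult_mat[of _ nv nv _ nv _ nv])
  define G where "G = map_mat Re (f * mat_adjoint f)"
  note ids = kinetic_mat_identities[OF f h K F fF hK fh1 fh2, folded G_def]
  let ?R = "map_mat Re K" and ?J = "map_mat Im K"
  have J: "?J \<in> carrier_mat nv nv" and R: "?R \<in> carrier_mat nv nv" using K by auto
  have G: "G \<in> carrier_mat nv nv" using f by (simp add: G_def)
  then have G2: "- 2 \<cdot>\<^sub>m G \<in> carrier_mat nv nv" by simp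
  \<comment> \<open>This is the origin of the factor -1/2 in the result: \<open>G\<close> is -1/2
    times the inverse of \<open>?J\<close>.\<close>
  have Ji: "mat_inv ?J = - 2 \<cdot>\<^sub>m G" by (rule mat_inv_eqI[OF J G2 ids(2)])
  have GJ: "(- 2 \<cdot>\<^sub>m G) * ?J = 1\<^sub>m nv" by (rule mat_mult_left_right_inverse[OF J G2 ids(2)])
  define x where "x = ?R *\<^sub>v g - e"
  define y where "y = ?J *\<^sub>v g"
  define v where "v = K *\<^sub>v map_vec of_real g - map_vec of_real e"
  have x: "x \<in> carrier_vec nv" and y: "y \<in> carrier_vec nv" and v: "v \<in> carrier_vec nv"
    using J R K g e by (auto simp: x_def y_def v_def)
  have v_eq: "v $ i = Complex (x $ i) (y $ i)" if "i < nv" for i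
    using that K g e by (simp add: v_def x_def y_def scalar_prod_def complex_eq_iff)
  define z where "z = h\<^sup>T *\<^sub>v map_vec of_real g - f\<^sup>T *\<^sub>v map_vec of_real e"
  \<comment> \<open>Symmetry of \<open>K\<close> enters here; it lets \<open>f\<^sup>T\<close> be
    factored out of both terms of \<open>z\<close>.\<close>
  have "h\<^sup>T = f\<^sup>T * K"
    using transpose_mult[OF K f] ids(1) by (simp add: hK)
  then have z_eq: "z = f\<^sup>T *\<^sub>v v"
    using f K g e unfolding z_def v_def
    by (simp add: mult_minus_distrib_mat_vec[of _ nv nv] assoc_mult_mat_vec[of _ nv nv _ nv])
  have "Re (z \<bullet>c z) = x \<bullet> (G *\<^sub>v x) + y \<bullet> (G *\<^sub>v y)"
    unfolding z_eq cnj_transpose_mult_vec_scalar_prod[OF f v]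
    using real_matrix_hermitian_form[OF G x y v v_eq] ids(3) by simp
  also have "x \<bullet> (G *\<^sub>v x) = - 1/2 * (x \<bullet> (mat_inv ?J *\<^sub>v x))"
    using G x by (simp add: Ji smult_mat_mult_vec[of _ nv nv])
  \<comment> \<open>Because \<open>y\<close> is \<open>?J *\<^sub>v g\<close>, applying
    \<open>G\<close> undoes \<open>?J\<close> up to the factor -1/2.\<close>
  also have "y \<bullet> (G *\<^sub>v y) = - 1/2 * (g \<bullet> (?J *\<^sub>v g))"
  proof -
    have "(- 2 \<cdot>\<^sub>m G) *\<^sub>v y = g"
      using assoc_mult_mat_vec[OF G2 J g] GJ g by (simp add: y_def)
    then have "y \<bullet> g = - 2 * (y \<bullet> (G *\<^sub>v y))"
      using G y smult_mat_mult_vec[OF G y, of "- 2"] by auto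
    then show ?thesis using comm_scalar_prod[OF y g] by (simp add: y_def)
  qed
  also have "- 1/2 * (x \<bullet> (mat_inv ?J *\<^sub>v x)) + - 1/2 * (g \<bullet> (?J *\<^sub>v g))
      = - (1/2) * ((g @\<^sub>v e) \<bullet> (M_mat K *\<^sub>v (g @\<^sub>v e)))"
    using M_mat_quadratic_form[OF K ids(1) _ g e] G2 by (simp add: Ji x_def field_simps)
  \<comment> \<open>Only the real part has been computed so far; \<open>z \<bullet>c z\<close> is
    nonnegative in the order on complex numbers, so its imaginary part is zero.\<close>
  finally have "z \<bullet>c z = complex_of_real (- (1/2) * ((g @\<^sub>v e) \<bullet> (M_mat K *\<^sub>v (g @\<^sub>v e))))"
    using conjugate_square_ge_0_vec[of z] by (simp add: complex_eq_iff less_eq_complex_def)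
  then show ?thesis
    using invertible_matI[OF f F fF] invertible_matI[OF J G2 ids(2)]
      sum_Z_eq_sum_columns[OF c f h g e] by (simp add: K_def z_def)
qed

end
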